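(* Let $k\ge 2$ be an integer and let $G$ be a $k$-degenerated graph without isolated edges. Then $$\chi_{1-vsdt}(G)\le k\Delta(G)+3,$$ where $\Delta(G)$ is the maximum degree of $G$.
   Context: All graphs are finite, simple and undirected. A graph $G$ is $k$-degenerated if $\delta(H)\le k$ for every subgraph $H$ of $G$, where $\delta(H)$ is the minimum degree. For a vertex $u$ of $G$, let $N\langle u\rangle = N[u]\cup\{uv : v\in N(u)\}$, where $N(u)$ and $N[u]=N(u)\cup\{u\}$ are the open and closed neighborhoods; so $N\langle u\rangle$ consists of $u$, its neighbors and its incident edges. A proper $\kappa$-total coloring of $G$ is a map $f:V(G)\cup E(G)\to\{1,\dots,\kappa\}$ such that any two adjacent vertices, any two edges sharing an endpoint, and any vertex and incident edge receive different colors. Put $C_f\langle u\rangle=\{f(x): x\in N\langle u\rangle\}$. For a graph $G$ with no isolated edges (no connected component is $K_2$), a $\kappa$-$D(1)$-VSDTC of $G$ ($1$-vertex-strongly-distinguishing total coloring) is a proper $\kappa$-total coloring $f$ such that $C_f\langle u\rangle\neq C_f\langle v\rangle$ for any two adjacent vertices $u,v$. $\chi_{1-vsdt}(G)$ is the minimum $\kappa$ for which $G$ admits a $\kappa$-$D(1)$-VSDTC. *)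

theory Defs
  imports Complex_Main
begin

text \<open>A graph is given by a vertex set \<open>V\<close> and a set \<open>E\<close> of edges, each edge being a set of
  exactly two vertices. The graph without vertices is admitted.\<close>

locale simple_graph =
  fixes V :: "'a set" and E :: "'a set set"
  assumes finite_V: "finite V"
    and edges: "e \<in> E \<Longrightarrow> e \<subseteq> V \<and> card e = 2"

definition nbrs :: "'a set set \<Rightarrow> 'a \<Rightarrow> 'a set" where
  "nbrs E u = {v. {u, v} \<in> E}"

definition closed_nbrs :: "'a set set \<Rightarrow> 'a \<Rightarrow> 'a set" where
  "closed_nbrs E u = insert u (nbrs E u)"

definition degree :: "'a set set \<Rightarrow> 'a \<Rightarrow> nat" where
  "degree E u = card (nbrs E u)"

text \<open>On finite sets of naturals the supremum is the maximum, and it is \<open>0\<close> for the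
  empty set; so the graph without vertices has maximum degree \<open>0\<close>.\<close>

definition max_degree :: "'a set \<Rightarrow> 'a set set \<Rightarrow> nat" where
  "max_degree V E = (SUP u\<in>V. degree E u)"

text \<open>Only meaningful for \<open>V \<noteq> {}\<close>.\<close>

definition min_degree :: "'a set \<Rightarrow> 'a set set \<Rightarrow> nat" where
  "min_degree V E = Min (degree E ` V)"

definition subgraph :: "'a set \<Rightarrow> 'a set set \<Rightarrow> 'a set \<Rightarrow> 'a set set \<Rightarrow> bool" where
  "subgraph V' E' V E \<longleftrightarrow> simple_graph V' E' \<and> V' \<subseteq> V \<and> E' \<subseteq> E"

definition degenerated :: "nat \<Rightarrow> 'a set \<Rightarrow> 'a set set \<Rightarrow> bool" where
  "degenerated k V E \<longleftrightarrow>
    (\<forall>V' E'. subgraph V' E' V E \<and> V' \<noteq> {} \<longrightarrow> min_degree V' E' \<le> k)"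

definition components :: "'a set \<Rightarrow> 'a set set \<Rightarrow> 'a set set" where
  "components V E = V // {(u, v). u \<in> V \<and> v \<in> V \<and> (u, v) \<in> {(x, y). {x, y} \<in> E}\<^sup>*}"

definition no_isolated_edges :: "'a set \<Rightarrow> 'a set set \<Rightarrow> bool" where
  "no_isolated_edges V E \<longleftrightarrow> (\<nexists>u v. u \<noteq> v \<and> {u, v} \<in> components V E \<and> {u, v} \<in> E)"

text \<open>In a total coloring, vertices are tagged with \<open>Inl\<close> and edges with \<open>Inr\<close>.\<close>

definition total_nbhd :: "'a set set \<Rightarrow> 'a \<Rightarrow> ('a + 'a set) set" where
  "total_nbhd E u = closed_nbrs E u <+> {{u, v} |v. v \<in> nbrs E u}"

definition proper_total_coloring ::
    "'a set \<Rightarrow> 'a set set \<Rightarrow> nat \<Rightarrow> ('a + 'a set \<Rightarrow> nat) \<Rightarrow> bool" where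
  "proper_total_coloring V E \<kappa> f \<longleftrightarrow>
     f ` (V <+> E) \<subseteq> {1..\<kappa>} \<and>
     (\<forall>u v. {u, v} \<in> E \<longrightarrow> f (Inl u) \<noteq> f (Inl v)) \<and>
     (\<forall>e\<in>E. \<forall>e'\<in>E. e \<noteq> e' \<and> e \<inter> e' \<noteq> {} \<longrightarrow> f (Inr e) \<noteq> f (Inr e')) \<and>
     (\<forall>e\<in>E. \<forall>v\<in>e. f (Inl v) \<noteq> f (Inr e))"

definition color_set :: "'a set set \<Rightarrow> ('a + 'a set \<Rightarrow> nat) \<Rightarrow> 'a \<Rightarrow> nat set" where
  "color_set E f u = f ` total_nbhd E u"

definition D1_VSDTC ::
    "'a set \<Rightarrow> 'a set set \<Rightarrow> nat \<Rightarrow> ('a + 'a set \<Rightarrow> nat) \<Rightarrow> bool" where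
  "D1_VSDTC V E \<kappa> f \<longleftrightarrow> proper_total_coloring V E \<kappa> f \<and>
     (\<forall>u v. {u, v} \<in> E \<longrightarrow> color_set E f u \<noteq> color_set E f v)"

definition chi_1vsdt :: "'a set \<Rightarrow> 'a set set \<Rightarrow> nat" where
  "chi_1vsdt V E = (LEAST \<kappa>. \<exists>f. D1_VSDTC V E \<kappa> f)"

text \<open>The minimum in \<open>chi_1vsdt\<close> is taken over a nonempty set: giving distinct colors to all
  vertices and edges works as soon as there is no isolated edge.\<close>

lemma (in simple_graph) ex_D1_VSDTC:
  assumes iso: "no_isolated_edges V E"
  shows "\<exists>\<kappa> f. D1_VSDTC V E \<kappa> f"
proof -
  have EV: "E \<subseteq> Pow V" using edges by blast
  have "finite (V <+> E)"
    using finite_V EV by (meson finite_Pow_iff finite_Plus finite_subset)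
  then obtain f0 :: "'a + 'a set \<Rightarrow> nat" where f0: "inj_on f0 (V <+> E)"
    using finite_imp_inj_to_nat_seg by blast
  define f where "f = Suc \<circ> f0"
  have inj: "inj_on f (V <+> E)" using f0 by (simp add: f_def inj_on_def)
  obtain \<kappa> where "f ` (V <+> E) \<subseteq> {..\<kappa>}"
    using \<open>finite (V <+> E)\<close> by (metis finite_imageI finite_nat_set_iff_bounded_le atMost_iff subsetI)
  then have range: "f ` (V <+> E) \<subseteq> {1..\<kappa>}" by (force simp: f_def)
  have ne: "u \<noteq> v \<and> u \<in> V \<and> v \<in> V" if "{u, v} \<in> E" for u v
    using edges[OF that] by (auto simp: card_2_iff doubleton_eq_iff)
  have "proper_total_coloring V E \<kappa> f"
    unfolding proper_total_coloring_def
    using range ne EV by (auto dest!: inj_onD[OF inj])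
  moreover have "color_set E f u \<noteq> color_set E f v" if uv: "{u, v} \<in> E" for u v
  proof
    assume "color_set E f u = color_set E f v"
    moreover have sub: "total_nbhd E x \<subseteq> V <+> E" if "x \<in> V" for x
      using that ne by (auto simp: total_nbhd_def closed_nbrs_def nbrs_def)
    ultimately have eq: "total_nbhd E u = total_nbhd E v"
      using inj_on_image_eq_iff[OF inj sub sub] ne[OF uv] by (simp add: color_set_def)
    have only_u: "w = v" if "{u, w} \<in> E" for w
    proof -
      have "Inr {u, w} \<in> total_nbhd E u"
        using that by (auto simp: total_nbhd_def nbrs_def)
      then have "Inr {u, w} \<in> total_nbhd E v" by (simp only: eq)
      then show ?thesis using ne[OF uv] by (auto simp: total_nbhd_def doubleton_eq_iff)
    qed
    have only_v: "w = u" if "{v, w} \<in> E" for w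
    proof -
      have "Inr {v, w} \<in> total_nbhd E v"
        using that by (auto simp: total_nbhd_def nbrs_def)
      then have "Inr {v, w} \<in> total_nbhd E u" by (simp only: eq)
      then show ?thesis using ne[OF uv] by (auto simp: total_nbhd_def doubleton_eq_iff)
    qed
    let ?R = "{(x, y). {x, y} \<in> E}"
    have "w \<in> {u, v}" if "(u, w) \<in> ?R\<^sup>*" for w
      using that by induction (use only_u only_v in auto)
    then have "{(x, y). x \<in> V \<and> y \<in> V \<and> (x, y) \<in> ?R\<^sup>*} `` {u} = {u, v}"
      using ne[OF uv] uv by auto
    moreover have "{(x, y). x \<in> V \<and> y \<in> V \<and> (x, y) \<in> ?R\<^sup>*} `` {u} \<in> components V E"
      unfolding components_def by (rule quotientI) (simp add: ne[OF uv])
    ultimately have "{u, v} \<in> components V E" by (simp only:)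
    then show False using iso uv ne[OF uv] unfolding no_isolated_edges_def by blast
  qed
  ultimately show ?thesis unfolding D1_VSDTC_def by blast
qed

end

theory Submission
  imports Defs
begin

text \<open>Color the vertices greedily with \<open>k + 1\<close> colors and the edges with the remaining
  \<open>k * (\<Delta> - 1) + 2\<close> colors, such that adjacent vertices see different sets of edge colors. The edge
  coloring is obtained by induction on the number of edges: either remove an edge \<open>xy\<close> with
  \<open>deg y < deg x\<close>, so that \<open>x\<close> and \<open>y\<close> are distinguished by their degrees, or a path \<open>xyz\<close> with
  \<open>deg y = deg z\<close>, coloring \<open>xy\<close> first in such a way that \<open>y\<close> and \<open>z\<close> are distinguished before \<open>yz\<close> is
  colored. Degeneracy provides such an edge or path for which the number of forbidden colors is
  smaller than the size of the palette. For \<open>\<Delta> = 2\<close> one edge color is missing (the 5-cycle has no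
  neighbor-distinguishing edge coloring with 4 colors), and vertex colors have to be shared with the
  edges.\<close>

section \<open>Neighborhoods, incident edges and degrees\<close>

lemma nbrs_sym: "v \<in> nbrs E u \<longleftrightarrow> u \<in> nbrs E v"
  by (simp add: nbrs_def insert_commute)

lemma nbrs_neq: "\<forall>e\<in>E. card e = 2 \<Longrightarrow> v \<in> nbrs E u \<Longrightarrow> u \<noteq> v"
  by (auto simp: nbrs_def)

lemma inc_eq_image:
  assumes "\<forall>e\<in>E. card e = 2"
  shows "{e \<in> E. u \<in> e} = (\<lambda>v. {u, v}) ` nbrs E u"
  using assms by (fastforce simp: nbrs_def card_2_iff insert_commute)

lemma degree_eq_card_inc:
  assumes "\<forall>e\<in>E. card e = 2"
  shows "degree E u = card {e \<in> E. u \<in> e}"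
  unfolding degree_def inc_eq_image[OF assms]
  by (rule card_image[symmetric]) (auto simp: inj_on_def doubleton_eq_iff)

lemma finite_nbrs:
  assumes "\<forall>e\<in>E. card e = 2" "finite E"
  shows "finite (nbrs E u)"
proof -
  have "finite ((\<lambda>v. {u, v}) ` nbrs E u)"
    unfolding inc_eq_image[OF assms(1), symmetric] using assms(2) by simp
  then show ?thesis
    by (rule finite_imageD) (auto simp: inj_on_def doubleton_eq_iff)
qed

lemma degree_insert:
  assumes "\<forall>e\<in>E. card e = 2" "finite E" "x \<noteq> y" "{x, y} \<notin> E"
  shows "degree (insert {x, y} E) u = degree E u + (if u = x \<or> u = y then 1 else 0)"
proof -
  have 2: "\<forall>e\<in>insert {x, y} E. card e = 2" using assms by simp
  have "{e \<in> insert {x, y} E. u \<in> e} =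
      (if u = x \<or> u = y then insert {x, y} {e \<in> E. u \<in> e} else {e \<in> E. u \<in> e})"
    by auto
  then show ?thesis
    unfolding degree_eq_card_inc[OF 2] degree_eq_card_inc[OF assms(1)]
    using assms by simp
qed

section \<open>Neighbor-distinguishing edge colorings\<close>

definition edge_colors :: "'a set set \<Rightarrow> ('a set \<Rightarrow> nat) \<Rightarrow> 'a \<Rightarrow> nat set" where
  "edge_colors E g u = g ` {e \<in> E. u \<in> e}"

text \<open>\<open>T\<close> lists the pairs of vertices to be distinguished; it need not consist of edges.\<close>

definition dist_edge_coloring ::
    "nat set \<Rightarrow> 'a set set \<Rightarrow> 'a set set \<Rightarrow> ('a set \<Rightarrow> nat) \<Rightarrow> bool" where
  "dist_edge_coloring K E T g \<longleftrightarrow> g ` E \<subseteq> K \<and>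
     (\<forall>e\<in>E. \<forall>e'\<in>E. e \<noteq> e' \<and> e \<inter> e' \<noteq> {} \<longrightarrow> g e \<noteq> g e') \<and>
     (\<forall>u v. u \<noteq> v \<longrightarrow> {u, v} \<in> T \<longrightarrow> edge_colors E g u \<noteq> edge_colors E g v)"

text \<open>Properness makes \<open>g\<close> injective on the edges at \<open>u\<close>. Hence
  vertices of different degree never see the same color set, and only pairs of equal degree need
  care.\<close>

lemma card_edge_colors:
  assumes "\<forall>e\<in>E. card e = 2" "dist_edge_coloring K E T g"
  shows "card (edge_colors E g u) = degree E u"
  unfolding edge_colors_def degree_eq_card_inc[OF assms(1)]
  by (rule card_image) (use assms(2) in \<open>force simp: inj_on_def dist_edge_coloring_def\<close>)

lemma finite_edge_colors: "finite E \<Longrightarrow> finite (edge_colors E g u)"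
  by (simp add: edge_colors_def)

lemma edge_colors_insert:
  assumes "{x, y} \<notin> E"
  shows "edge_colors (insert {x, y} E) (g({x, y} := a)) u =
    (if u = x \<or> u = y then insert a (edge_colors E g u) else edge_colors E g u)"
proof -
  have "g({x, y} := a) ` {e \<in> E. u \<in> e} = g ` {e \<in> E. u \<in> e}"
    using assms by (intro image_cong) auto
  moreover have "{e \<in> insert {x, y} E. u \<in> e} =
      (if u = x \<or> u = y then insert {x, y} {e \<in> E. u \<in> e} else {e \<in> E. u \<in> e})"
    by auto
  ultimately show ?thesis
    unfolding edge_colors_def
    by (cases "u = x \<or> u = y") (simp_all only: if_True if_False image_insert fun_upd_same)
qed

text \<open>For each neighbor \<open>u\<close> there is at most one color \<open>a\<close> that makes the color sets of \<open>x\<close> and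
  \<open>u\<close> coincide; \<open>X\<close> and \<open>Y\<close> collect the vertices for which such a color can exist.\<close>

lemma extend_edge:
  assumes g: "dist_edge_coloring K E T0 g" and fin: "finite E" "finite X" "finite Y"
    and xy: "x \<noteq> y" "{x, y} \<notin> E"
    and X: "\<And>u a. {x, u} \<in> T \<Longrightarrow> u \<noteq> x \<Longrightarrow> u \<noteq> y \<Longrightarrow> u \<notin> X \<Longrightarrow> a \<notin> edge_colors E g x \<Longrightarrow>
            insert a (edge_colors E g x) \<noteq> edge_colors E g u"
    and Y: "\<And>u a. {y, u} \<in> T \<Longrightarrow> u \<noteq> x \<Longrightarrow> u \<noteq> y \<Longrightarrow> u \<notin> Y \<Longrightarrow> a \<notin> edge_colors E g y \<Longrightarrow>
            insert a (edge_colors E g y) \<noteq> edge_colors E g u"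
    and T: "{x, y} \<in> T \<Longrightarrow> edge_colors E g x \<noteq> edge_colors E g y"
    and T0: "\<And>e. e \<in> T \<Longrightarrow> x \<notin> e \<Longrightarrow> y \<notin> e \<Longrightarrow> e \<in> T0"
    and card: "card (edge_colors E g x \<union> edge_colors E g y) + card X + card Y < card K"
  obtains a where "a \<notin> edge_colors E g x" "a \<notin> edge_colors E g y"
    "dist_edge_coloring K (insert {x, y} E) T (g({x, y} := a))"
proof -
  let ?c = "edge_colors E g"
  \<comment> \<open>\<open>F\<close> holds the colors barred from \<open>{x, y}\<close>. Where a
    difference of color sets is not a singleton, \<open>the_elem\<close> is unspecified; this only
    bars one more color, already counted in \<open>card X\<close> or \<open>card Y\<close>.\<close>
  define F where "F = (?c x \<union> ?c y) \<union> (\<lambda>u. the_elem (?c u - ?c x)) ` X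
      \<union> (\<lambda>u. the_elem (?c u - ?c y)) ` Y"
  have "card F \<le> card (?c x \<union> ?c y) + card X + card Y"
    unfolding F_def
    using card_Un_le[of "(?c x \<union> ?c y) \<union> (\<lambda>u. the_elem (?c u - ?c x)) ` X"
        "(\<lambda>u. the_elem (?c u - ?c y)) ` Y"]
      card_Un_le[of "?c x \<union> ?c y" "(\<lambda>u. the_elem (?c u - ?c x)) ` X"]
      card_image_le[OF fin(2), of "\<lambda>u. the_elem (?c u - ?c x)"]
      card_image_le[OF fin(3), of "\<lambda>u. the_elem (?c u - ?c y)"] by linarith
  moreover have "finite F" unfolding F_def using fin by (simp add: finite_edge_colors)
  ultimately have "\<not> K \<subseteq> F" using card card_mono[of F K] by linarith
  then obtain a where a: "a \<in> K" "a \<notin> F" by blast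
  have ax: "a \<notin> ?c x" and ay: "a \<notin> ?c y" using a(2) by (auto simp: F_def)
  let ?E = "insert {x, y} E" and ?g = "g({x, y} := a)"
  have new: "edge_colors ?E ?g u = (if u = x \<or> u = y then insert a (?c u) else ?c u)" for u
    by (rule edge_colors_insert[OF xy(2)])
  have the: "the_elem (A - B) = a" if "insert a B = A" "a \<notin> B" for A B
  proof -
    have "A - B = {a}" using that by auto
    then show ?thesis by simp
  qed
  have dx: "insert a (?c x) \<noteq> ?c u" if u: "{x, u} \<in> T" "u \<noteq> x" "u \<noteq> y" for u
  proof
    assume eq: "insert a (?c x) = ?c u"
    then have "u \<in> X" using X[OF u] ax by blast
    moreover have "the_elem (?c u - ?c x) = a" using the[OF eq ax] .
    ultimately have "a \<in> F" unfolding F_def by (metis UnCI image_eqI)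
    then show False using a by simp
  qed
  have dy: "insert a (?c y) \<noteq> ?c u" if u: "{y, u} \<in> T" "u \<noteq> x" "u \<noteq> y" for u
  proof
    assume eq: "insert a (?c y) = ?c u"
    then have "u \<in> Y" using Y[OF u] ay by blast
    moreover have "the_elem (?c u - ?c y) = a" using the[OF eq ay] .
    ultimately have "a \<in> F" unfolding F_def by (metis UnCI image_eqI)
    then show False using a by simp
  qed
  \<comment> \<open>The new color lies in neither old set, so cancelling it would make the old sets
    equal.\<close>
  have dxy: "insert a (?c x) \<noteq> insert a (?c y)" if "{x, y} \<in> T"
    using T[OF that] ax ay by (metis Diff_insert_absorb)
  have "edge_colors ?E ?g u \<noteq> edge_colors ?E ?g v" if uv: "u \<noteq> v" "{u, v} \<in> T" for u v
  proof -
    have vu: "{v, u} \<in> T" using uv by (simp add: insert_commute)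
    consider "u = x" "v = y" | "u = y" "v = x" | "u = x" "v \<noteq> y" | "u = y" "v \<noteq> x"
      | "v = x" "u \<noteq> y" | "v = y" "u \<noteq> x" | "u \<noteq> x" "u \<noteq> y" "v \<noteq> x" "v \<noteq> y" by blast
    then show ?thesis
    proof cases
      case 1 then show ?thesis using dxy uv new by simp
    next
      case 2 then show ?thesis using dxy vu new by auto
    next
      case 3 then show ?thesis using dx[of v] uv new by auto
    next
      case 4 then show ?thesis using dy[of v] uv new by auto
    next
      case 5 then show ?thesis using dx[of u] uv vu new by auto
    next
      case 6 then show ?thesis using dy[of u] uv vu new by auto
    next
      case 7
      then have "{u, v} \<in> T0" using T0 uv by auto
      then show ?thesis using g uv 7 new by (simp add: dist_edge_coloring_def)
    qed
  qed
  moreover have "g e \<noteq> a" if "e \<in> E" "e \<inter> {x, y} \<noteq> {}" for e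
    using that ax ay by (auto simp: edge_colors_def)
  then have "\<forall>e\<in>?E. \<forall>e'\<in>?E. e \<noteq> e' \<and> e \<inter> e' \<noteq> {} \<longrightarrow> ?g e \<noteq> ?g e'"
    using g xy(2) unfolding dist_edge_coloring_def by (metis Int_commute fun_upd_apply insert_iff)
  moreover have "?g ` ?E \<subseteq> K"
    using a(1) g by (auto simp: dist_edge_coloring_def)
  ultimately have "dist_edge_coloring K ?E T ?g"
    unfolding dist_edge_coloring_def by blast
  then show thesis using that ax ay by blast
qed

text \<open>The two ends of a single edge component see the same color and cannot be distinguished.\<close>

definition dist_edges :: "'a set set \<Rightarrow> 'a set set" where
  "dist_edges E = {e \<in> E. \<exists>u\<in>e. 2 \<le> degree E u}"

section \<open>Reinserting a single edge or a path of two edges\<close>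

text \<open>Degrees separate \<open>x\<close> from \<open>y\<close> and \<open>y\<close> from its
  other neighbors, so only neighbors of \<open>x\<close> of the same degree can clash. The ends
  already see at most \<open>(degree E x - 1) + (degree E y - 1)\<close> colors, whence the
  \<open>2\<close> in the bound. \<open>deg\<close> is restricted to \<open>dist_edges E\<close> to
  admit an isolated edge.\<close>

lemma extend_one:
  assumes E0: "\<forall>e\<in>E0. card e = 2" "finite E0" and xy: "x \<noteq> y" "{x, y} \<notin> E0"
    and E: "E = insert {x, y} E0"
    and g: "dist_edge_coloring K E0 (dist_edges E0) g"
    and deg: "{x, y} \<in> dist_edges E \<Longrightarrow> degree E y \<noteq> degree E x"
    and ny: "\<And>u. u \<in> nbrs E y \<Longrightarrow> u \<noteq> x \<Longrightarrow> degree E u \<noteq> degree E y"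
    and card: "degree E x + degree E y + card {u \<in> nbrs E x - {y}. degree E u = degree E x} < card K + 2"
  shows "\<exists>g. dist_edge_coloring K E (dist_edges E) g"
proof -
  have dE: "degree E u = degree E0 u + (if u = x \<or> u = y then 1 else 0)" for u
    unfolding E by (rule degree_insert[OF E0 xy])
  have E2: "\<forall>e\<in>E. card e = 2" "finite E" using E0 xy E by auto
  note c = card_edge_colors[OF E0(1) g]
  have ci: "card (insert a (edge_colors E0 g u)) = degree E0 u + 1"
    if "a \<notin> edge_colors E0 g u" for a u
    using c that finite_edge_colors[OF E0(2)] by simp
  let ?X = "{u \<in> nbrs E x - {y}. degree E u = degree E x}"
  have "card (edge_colors E0 g x \<union> edge_colors E0 g y) + card ?X + card {} < card K"
    using card_Un_le[of "edge_colors E0 g x" "edge_colors E0 g y"] card dE[of x] dE[of y]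
    by (simp add: c)
  then obtain a where "dist_edge_coloring K (insert {x, y} E0) (dist_edges E) (g({x, y} := a))"
  proof (rule extend_edge[rotated -2, where x = x and y = y and T = "dist_edges E", OF _ _ g E0(2)])
    show "finite ?X" using finite_nbrs[OF E2] by simp
    show "finite {}" by simp
    show "x \<noteq> y" "{x, y} \<notin> E0" using xy by auto
  next
    fix u a
    assume u: "{x, u} \<in> dist_edges E" "u \<noteq> x" "u \<noteq> y" "u \<notin> ?X" "a \<notin> edge_colors E0 g x"
    then have "degree E u \<noteq> degree E x" by (auto simp: dist_edges_def nbrs_def)
    then show "insert a (edge_colors E0 g x) \<noteq> edge_colors E0 g u"
      using ci[OF u(5)] c[of u] dE[of u] dE[of x] u by auto
  next
    fix u a
    assume u: "{y, u} \<in> dist_edges E" "u \<noteq> x" "u \<noteq> y" "a \<notin> edge_colors E0 g y"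
    then have "degree E u \<noteq> degree E y" using ny by (auto simp: dist_edges_def nbrs_def)
    then show "insert a (edge_colors E0 g y) \<noteq> edge_colors E0 g u"
      using ci[OF u(4)] c[of u] dE[of u] dE[of y] u by auto
  next
    assume "{x, y} \<in> dist_edges E"
    then show "edge_colors E0 g x \<noteq> edge_colors E0 g y"
      using deg c[of x] c[of y] dE[of x] dE[of y] by auto
  next
    fix e assume e: "e \<in> dist_edges E" "x \<notin> e" "y \<notin> e"
    then have "e \<in> E0" unfolding dist_edges_def E by auto
    moreover obtain u where "u \<in> e" "2 \<le> degree E u" using e by (auto simp: dist_edges_def)
    moreover have "u \<noteq> x" "u \<noteq> y" using \<open>u \<in> e\<close> e by auto
    ultimately show "e \<in> dist_edges E0" unfolding dist_edges_def using dE[of u] by auto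
  qed
  then show ?thesis using E by blast
qed

text \<open>\<open>xy\<close> is colored first, with the extra demand that \<open>y\<close> and
  \<open>z\<close> see different sets; the color of \<open>yz\<close> joins both sets and cannot
  spoil this. The first step bars at most \<open>(degree E x - 1) + (d - 2)\<close> seen colors, the
  clashes at \<open>x\<close> and one color for \<open>z\<close>. The second bars at most
  \<open>(2 * d - 2) + (d - 2) + (d - 1)\<close> colors if \<open>x\<close> cannot clash with
  \<open>y\<close>, and otherwise \<open>d + (d - 1) + (d - 1)\<close>, because \<open>sub\<close>
  then makes the colors at \<open>y\<close> and \<open>z\<close> overlap.\<close>

lemma extend_two:
  assumes E0: "\<forall>e\<in>E0. card e = 2" "finite E0" and ne: "x \<noteq> y" "y \<noteq> z" "x \<noteq> z"
    and notin: "{x, y} \<notin> E0" "{y, z} \<notin> E0"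
    and E: "E = insert {y, z} (insert {x, y} E0)"
    and g: "dist_edge_coloring K E0 (dist_edges E0) g"
    and d: "degree E y = d" "degree E z = d"
    and sub: "degree E x = d \<Longrightarrow> edge_colors E0 g y \<subseteq> edge_colors E0 g z
        \<or> \<not> edge_colors E0 g y \<subseteq> edge_colors E0 g x"
    and card1: "degree E x + d + card {u \<in> nbrs E x - {y}. degree E u = degree E x} < card K + 2"
    and card2: "4 * d < card K + 5" "3 * d < card K + 2"
  shows "\<exists>g. dist_edge_coloring K E (dist_edges E) g"
proof -
  let ?E1 = "insert {x, y} E0"
  have E1: "\<forall>e\<in>?E1. card e = 2" "finite ?E1" using E0 ne by auto
  have notin1: "{y, z} \<notin> ?E1" using notin ne by (auto simp: doubleton_eq_iff)
  have E2: "\<forall>e\<in>E. card e = 2" "finite E" using E1 ne E by auto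
  have d1: "degree ?E1 u = degree E0 u + (if u = x \<or> u = y then 1 else 0)" for u
    by (rule degree_insert[OF E0 ne(1) notin(1)])
  have d2: "degree E u = degree ?E1 u + (if u = y \<or> u = z then 1 else 0)" for u
    unfolding E by (rule degree_insert[OF E1 ne(2) notin1])
  note c0 = card_edge_colors[OF E0(1) g]
  note fn = finite_nbrs[OF E2] and f0 = finite_edge_colors[OF E0(2)]
  have ci0: "card (insert a (edge_colors E0 g u)) = degree E0 u + 1"
    if "a \<notin> edge_colors E0 g u" for a u
    using c0 that f0 by simp
  have d0: "degree E0 y + 2 = d" "degree E0 z + 1 = d" "degree E0 x + 1 = degree E x"
    using d1[of y] d2[of y] d1[of z] d2[of z] d1[of x] d2[of x] d ne by auto
  let ?X = "{u \<in> nbrs E x - {y}. degree E u = degree E x}"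
  \<comment> \<open>The color sets of \<open>y\<close> and \<open>z\<close> are still incomplete
    here, so the other pairs meeting \<open>y\<close> or \<open>z\<close> are left to the second
    step.\<close>
  let ?T1 = "insert {y, z} {e \<in> dist_edges E. y \<notin> e \<and> z \<notin> e}"
  have "card (edge_colors E0 g x \<union> edge_colors E0 g y) + card ?X + card {z} < card K"
    using card_Un_le[of "edge_colors E0 g x" "edge_colors E0 g y"] card1 d0
    by (simp add: c0)
  then obtain a where ax: "a \<notin> edge_colors E0 g x" and ay: "a \<notin> edge_colors E0 g y"
    and g1: "dist_edge_coloring K ?E1 ?T1 (g({x, y} := a))"
  proof (rule extend_edge[rotated -2, where x = x and y = y and T = ?T1, OF _ _ g E0(2)])
    show "finite ?X" using fn by simp
    show "finite {z}" by simp
    show "x \<noteq> y" "{x, y} \<notin> E0" using ne notin by auto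
  next
    fix u a
    assume u: "{x, u} \<in> ?T1" "u \<noteq> x" "u \<noteq> y" "u \<notin> ?X" "a \<notin> edge_colors E0 g x"
    then have "degree E u \<noteq> degree E x" "u \<noteq> z"
      using ne by (auto simp: dist_edges_def nbrs_def doubleton_eq_iff)
    then show "insert a (edge_colors E0 g x) \<noteq> edge_colors E0 g u"
      using ci0[OF u(5)] c0[of u] d1[of u] d2[of u] d0 u by auto
  next
    fix u a
    assume u: "{y, u} \<in> ?T1" "u \<noteq> x" "u \<noteq> y" "u \<notin> {z}"
    then show "insert a (edge_colors E0 g y) \<noteq> edge_colors E0 g u"
      by (auto simp: doubleton_eq_iff)
  next
    assume "{x, y} \<in> ?T1"
    then show "edge_colors E0 g x \<noteq> edge_colors E0 g y"
      using ne by (auto simp: doubleton_eq_iff)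
  next
    fix e assume "e \<in> ?T1" "x \<notin> e" "y \<notin> e"
    then have e: "e \<in> dist_edges E" "x \<notin> e" "y \<notin> e" "z \<notin> e" by auto
    then have "e \<in> E0" unfolding dist_edges_def E by auto
    moreover obtain u where "u \<in> e" "2 \<le> degree E u" using e by (auto simp: dist_edges_def)
    moreover have "u \<noteq> x" "u \<noteq> y" "u \<noteq> z" using \<open>u \<in> e\<close> e by auto
    ultimately show "e \<in> dist_edges E0" unfolding dist_edges_def using d1[of u] d2[of u] by auto
  qed
  let ?g1 = "g({x, y} := a)"
  note c1 = card_edge_colors[OF E1(1) g1]
  have col1: "edge_colors ?E1 ?g1 u =
      (if u = x \<or> u = y then insert a (edge_colors E0 g u) else edge_colors E0 g u)" for u
    by (rule edge_colors_insert[OF notin(1)])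
  have xy: "x \<in> nbrs E y" and zy: "z \<in> nbrs E y" and yz: "y \<in> nbrs E z"
    by (auto simp: E nbrs_def insert_commute)
  \<comment> \<open>If \<open>x\<close> and \<open>y\<close> agree once \<open>yz\<close> is
    colored, then \<open>x\<close> has degree \<open>d\<close> and, as \<open>a\<close> is new at
    \<open>y\<close>, all old colors at \<open>y\<close> occur at \<open>x\<close>. So
    \<open>x\<close> can clash only under \<open>?act\<close>, and then \<open>sub\<close> places
    these colors at \<open>z\<close> as well.\<close>
  let ?act = "degree E x = d \<and> edge_colors E0 g y \<subseteq> edge_colors E0 g x"
  let ?Y = "(nbrs E y - {x, z}) \<union> (if ?act then {x} else {})"
  let ?Z = "nbrs E z - {y}"
  have "card (nbrs E y - {x, z}) = d - 2"
    using d(1) xy zy ne fn by (simp add: degree_def card_Diff_subset)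
  then have cY: "card ?Y \<le> d - 2 + (if ?act then 1 else 0)"
    using card_Un_le[of "nbrs E y - {x, z}" "if ?act then {x} else {}"] by (auto split: if_splits)
  have cZ: "card ?Z = d - 1" using d(2) yz fn by (simp add: degree_def)
  have cYZ: "card (edge_colors ?E1 ?g1 y \<union> edge_colors ?E1 ?g1 z) \<le> (if ?act then d else 2 * d - 2)"
  proof (cases ?act)
    case True
    then have "edge_colors E0 g y \<subseteq> edge_colors E0 g z" using sub by blast
    then have "edge_colors ?E1 ?g1 y \<union> edge_colors ?E1 ?g1 z = insert a (edge_colors E0 g z)"
      using col1 ne by auto
    then show ?thesis using True d0 card_insert_le_m1[of d "edge_colors E0 g z" a] c0[of z] by simp
  next
    case False
    have "card (edge_colors ?E1 ?g1 y \<union> edge_colors ?E1 ?g1 z) \<le> 2 * d - 2"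
      using card_Un_le[of "edge_colors ?E1 ?g1 y" "edge_colors ?E1 ?g1 z"] d0 c1[of y] c1[of z]
        d1[of y] d1[of z] ne by simp
    then show ?thesis by (simp only: False if_False)
  qed
  have "card (edge_colors ?E1 ?g1 y \<union> edge_colors ?E1 ?g1 z) + card ?Y + card ?Z < card K"
    using cY cZ cYZ card2 d0 by (auto split: if_splits)
  then obtain b where "dist_edge_coloring K (insert {y, z} ?E1) (dist_edges E) (?g1({y, z} := b))"
  proof (rule extend_edge[rotated -2, where x = y and y = z and T = "dist_edges E", OF _ _ g1 E1(2)])
    show "finite ?Y" "finite ?Z" using fn by auto
    show "y \<noteq> z" "{y, z} \<notin> ?E1" using ne notin1 by auto
  next
    fix u b
    assume u: "{y, u} \<in> dist_edges E" "u \<noteq> y" "u \<noteq> z" "u \<notin> ?Y" "b \<notin> edge_colors ?E1 ?g1 y"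
    then have ux: "u = x" and act: "\<not> ?act"
      by (auto simp: dist_edges_def nbrs_def split: if_splits)
    show "insert b (edge_colors ?E1 ?g1 y) \<noteq> edge_colors ?E1 ?g1 u"
    proof
      assume eq: "insert b (edge_colors ?E1 ?g1 y) = edge_colors ?E1 ?g1 u"
      have "card (insert b (edge_colors ?E1 ?g1 y)) = d"
        using u(5) c1[of y] finite_edge_colors[OF E1(2)] d1[of y] d0 by simp
      then have "degree E x = d" using eq ux c1[of x] d2[of x] ne by simp
      moreover have "edge_colors E0 g y \<subseteq> edge_colors E0 g x"
        using eq ay unfolding ux col1 by auto
      ultimately show False using act by blast
    qed
  next
    fix u b
    assume u: "{z, u} \<in> dist_edges E" "u \<noteq> y" "u \<noteq> z" "u \<notin> ?Z"
    then show "insert b (edge_colors ?E1 ?g1 z) \<noteq> edge_colors ?E1 ?g1 u"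
      by (auto simp: dist_edges_def nbrs_def)
  next
    show "edge_colors ?E1 ?g1 y \<noteq> edge_colors ?E1 ?g1 z"
      using g1 ne unfolding dist_edge_coloring_def by blast
  next
    fix e assume "e \<in> dist_edges E" "y \<notin> e" "z \<notin> e"
    then show "e \<in> ?T1" by simp
  qed
  then show ?thesis using E by blast
qed

section \<open>Degeneracy and edges with ends of different degree\<close>

text \<open>Degeneracy through induced subgraphs and the edge set alone: points outside the graph
  have no neighbors, so \<open>U\<close> may be any finite set, and edges can be deleted without
  tracking vertices.\<close>

definition weakly_degenerate :: "nat \<Rightarrow> 'a set set \<Rightarrow> bool" where
  "weakly_degenerate k E \<longleftrightarrow>
    (\<forall>U. finite U \<longrightarrow> U \<noteq> {} \<longrightarrow> (\<exists>x\<in>U. card (nbrs E x \<inter> U) \<le> k))"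

lemma weakly_degenerate_subset:
  assumes "weakly_degenerate k E" "E' \<subseteq> E"
    and E: "\<forall>e\<in>E. card e = 2" "finite E"
  shows "weakly_degenerate k E'"
proof -
  have "card (nbrs E' x \<inter> U) \<le> card (nbrs E x \<inter> U)" for x U
    using finite_nbrs[OF E, of x] assms(2) by (intro card_mono) (auto simp: nbrs_def)
  then show ?thesis
    using assms(1) unfolding weakly_degenerate_def by (meson le_trans)
qed

lemma degree_pos: "v \<in> nbrs E u \<Longrightarrow> \<forall>e\<in>E. card e = 2 \<Longrightarrow> finite E \<Longrightarrow> 1 \<le> degree E u"
  using finite_nbrs[of E u] by (auto simp: degree_def Suc_le_eq card_gt_0_iff)

text \<open>If some degree exceeds \<open>k\<close>, the vertices of degree above \<open>k\<close> induce a subgraph with a vertex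
  \<open>x\<close> of degree at most \<open>k\<close>, and \<open>x\<close> must have a neighbor outside of it.\<close>

lemma unbalanced_edge:
  assumes E: "\<forall>e\<in>E. card e = 2" "finite E" and k: "weakly_degenerate k E"
    and ne: "{v, w} \<in> E" "degree E v \<noteq> degree E w \<or> k < degree E v"
  obtains x y where "{x, y} \<in> E" "degree E y < degree E x" "degree E y \<le> k"
    "card {u \<in> nbrs E x. degree E u = degree E x} \<le> k"
proof (cases "\<exists>u. k < degree E u")
  case True
  define B where "B = {u. k < degree E u}"
  have "B \<subseteq> \<Union>E"
  proof
    fix u assume "u \<in> B"
    then have "nbrs E u \<noteq> {}" by (auto simp: B_def degree_def)
    then show "u \<in> \<Union>E" by (auto simp: nbrs_def)
  qed
  moreover have "finite e" if "e \<in> E" for e using E that by (metis card.infinite zero_neq_numeral)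
  ultimately have fB: "finite B" using E(2) by (meson finite_Union finite_subset)
  obtain x where x: "x \<in> B" "card (nbrs E x \<inter> B) \<le> k"
    using k fB True unfolding weakly_degenerate_def B_def by blast
  have "\<not> nbrs E x \<subseteq> B"
    using x by (auto simp: B_def degree_def Int_absorb2)
  then obtain y where y: "y \<in> nbrs E x" "y \<notin> B" by blast
  have "card {u \<in> nbrs E x. degree E u = degree E x} \<le> card (nbrs E x \<inter> B)"
    by (rule card_mono) (use fB x in \<open>auto simp: B_def\<close>)
  then show thesis using that[of x y] x y by (auto simp: B_def nbrs_def)
next
  case False
  then have "degree E v \<noteq> degree E w" using ne by blast
  then obtain x y where xy: "{x, y} \<in> E" "degree E y < degree E x"
    using ne(1) by (metis insert_commute nat_neq_iff)
  have le: "degree E u \<le> k" for u using False by (simp add: not_less)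
  have "card {u \<in> nbrs E x. degree E u = degree E x} \<le> degree E x"
    unfolding degree_def[of E x] by (rule card_mono) (use finite_nbrs[OF E] in auto)
  also note le
  finally show thesis by (rule that[OF xy le])
qed

section \<open>Existence of the edge coloring, by induction on the number of edges\<close>

text \<open>The inequalities are the counts of the extension steps. For an edge with
  \<open>degree E y < degree E x\<close>, both \<open>degree E y\<close> and the number of clashes
  at \<open>x\<close> are at most \<open>min k (D - 1)\<close>. On a path with
  \<open>degree E y = degree E z = d\<close>, \<open>d \<le> min k D\<close> gives the last two.
  \<open>0 < card K\<close> serves an isolated edge.\<close>

theorem ex_dist_edge_coloring:
  assumes "\<forall>e\<in>E. card e = 2" "finite E" "weakly_degenerate k E" "\<And>u. degree E u \<le> D"
    and cK: "0 < card K" "D + 2 * min k (D - 1) < card K + 2"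
      "3 * min k D < card K + 2" "4 * min k D < card K + 5"
  shows "\<exists>g. dist_edge_coloring K E (dist_edges E) g"
  using assms(1-4)
proof (induction "card E" arbitrary: E rule: less_induct)
  case less
  note E = less.prems(1,2)
  have IH: "\<exists>g. dist_edge_coloring K E' (dist_edges E') g" if "E' \<subset> E" for E'
  proof (rule less.hyps)
    show "card E' < card E" using that E(2) by (rule psubset_card_mono[rotated])
    show "\<forall>e\<in>E'. card e = 2" "finite E'" using that E by (auto intro: finite_subset)
    show "weakly_degenerate k E'" using weakly_degenerate_subset[OF less.prems(3) _ E] that by blast
    fix u
    have "card (nbrs E' u) \<le> card (nbrs E u)"
      by (rule card_mono) (use finite_nbrs[OF E] that in \<open>auto simp: nbrs_def\<close>)
    then show "degree E' u \<le> D" using less.prems(4)[of u] by (simp add: degree_def)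
  qed
  note fn = finite_nbrs[OF E]
  show ?case
  proof (cases "E = {}")
    case True
    then show ?thesis by (auto simp: dist_edge_coloring_def dist_edges_def)
  next
    case False
    then obtain v w where vw: "{v, w} \<in> E" "v \<noteq> w" using E(1) by (metis all_not_in_conv card_2_iff)
    show ?thesis
    proof (cases "\<exists>v w. {v, w} \<in> E \<and> (degree E v \<noteq> degree E w \<or> k < degree E v)")
      case True
      then obtain v w where "{v, w} \<in> E" "degree E v \<noteq> degree E w \<or> k < degree E v" by blast
      then obtain x y where xy: "{x, y} \<in> E" "degree E y < degree E x" "degree E y \<le> k"
        "card {u \<in> nbrs E x. degree E u = degree E x} \<le> k"
        by (rule unbalanced_edge[OF E less.prems(3)])
      let ?X = "{u \<in> nbrs E x - {y}. degree E u = degree E x}"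
      have yx: "y \<in> nbrs E x" using xy(1) by (simp add: nbrs_def)
      have xney: "x \<noteq> y" using xy(2) by auto
      have "card ?X \<le> card {u \<in> nbrs E x. degree E u = degree E x}"
        by (rule card_mono) (use fn in auto)
      then have X1: "card ?X \<le> k" using xy(4) by simp
      have "card ?X \<le> card (nbrs E x - {y})" by (rule card_mono) (use fn in auto)
      also have "\<dots> = degree E x - 1" using yx fn by (simp add: degree_def)
      finally have X2: "card ?X \<le> D - 1" using less.prems(4)[of x] by simp
      have yD: "degree E y \<le> min k (D - 1)" using xy less.prems(4)[of x] by simp
      have bound: "degree E x + degree E y + card ?X < card K + 2"
      proof -
        have "card ?X \<le> min k (D - 1)" using X1 X2 by (rule min.boundedI)
        then show ?thesis using yD cK(2) less.prems(4)[of x] by linarith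
      qed
      show ?thesis
      proof (cases "\<exists>z\<in>nbrs E y. z \<noteq> x \<and> degree E z = degree E y")
        case True
        then obtain z where z: "z \<in> nbrs E y" "z \<noteq> x" "degree E z = degree E y" by blast
        have yz: "y \<noteq> z" using nbrs_neq[OF E(1) z(1)] .
        define E0 where "E0 = E - {{x, y}, {y, z}}"
        have "E0 \<subset> E" using xy(1) by (auto simp: E0_def)
        then obtain g where g: "dist_edge_coloring K E0 (dist_edges E0) g" using IH by blast
        show ?thesis
        \<comment> \<open>Here \<open>degree E y < degree E x\<close>, so \<open>sub\<close> holds
          vacuously.\<close>
        proof (rule extend_two[where x = x and y = y and z = z and d = "degree E y", OF _ _ _ _ _ _ _ _ g])
          show "\<forall>e\<in>E0. card e = 2" "finite E0" using E by (auto simp: E0_def)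
          show "x \<noteq> y" "y \<noteq> z" "x \<noteq> z" using xney yz z by auto
          show "{x, y} \<notin> E0" "{y, z} \<notin> E0" by (auto simp: E0_def)
          show "E = insert {y, z} (insert {x, y} E0)"
            using xy(1) z(1) by (auto simp: E0_def nbrs_def)
          show "4 * degree E y < card K + 5" "3 * degree E y < card K + 2"
            using yD cK(3,4) by auto
        qed (use z bound xy in auto)
      next
        case False
        define E0 where "E0 = E - {{x, y}}"
        have "E0 \<subset> E" using xy(1) by (auto simp: E0_def)
        then obtain g where g: "dist_edge_coloring K E0 (dist_edges E0) g" using IH by blast
        show ?thesis
        proof (rule extend_one[where x = x and y = y, OF _ _ _ _ _ g])
          show "\<forall>e\<in>E0. card e = 2" "finite E0" using E by (auto simp: E0_def)
          show "{x, y} \<notin> E0" by (auto simp: E0_def)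
          show "E = insert {x, y} E0" using xy(1) by (auto simp: E0_def)
        qed (use False bound xy xney in auto)
      qed
    next
      case False
      \<comment> \<open>Now every component is regular, of degree at most \<open>k\<close> if it has
        an edge.\<close>
      then have reg: "degree E u = degree E u'" "degree E u \<le> k" if "{u, u'} \<in> E" for u u'
        using that by (auto simp: not_less)
      define m where "m = degree E v"
      have w: "w \<in> nbrs E v" "degree E w = m" "m \<le> k" "m \<le> D"
        using reg[OF vw(1)] vw less.prems(4) by (auto simp: m_def nbrs_def)
      have m1: "1 \<le> m" using degree_pos[OF w(1) E] by (simp add: m_def)
      show ?thesis
      proof (cases "\<exists>x\<in>nbrs E v. x \<noteq> w")
        case True
        then obtain x where x: "x \<in> nbrs E v" "x \<noteq> w" by blast
        have xv: "x \<noteq> v" using nbrs_neq[OF E(1) x(1)] by simp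
        have dx: "degree E x = m" using reg[of v x] x by (simp add: m_def nbrs_def)
        define E0 where "E0 = E - {{x, v}, {v, w}}"
        have "E0 \<subset> E" using vw(1) by (auto simp: E0_def)
        then obtain g where g: "dist_edge_coloring K E0 (dist_edges E0) g" using IH by blast
        \<comment> \<open>One of the two orders of coloring the path satisfies the hypothesis \<open>sub\<close> of
          \<open>extend_two\<close>, which saves the one color that is missing for cubic graphs.\<close>
        have step: ?thesis if p: "{p, r} = {x, w}" "p \<noteq> r"
          and sub: "edge_colors E0 g v \<subseteq> edge_colors E0 g r \<or> \<not> edge_colors E0 g v \<subseteq> edge_colors E0 g p" for p r
        proof (rule extend_two[where x = p and y = v and z = r and d = m, OF _ _ _ _ _ _ _ _ g])
          show "\<forall>e\<in>E0. card e = 2" "finite E0" using E by (auto simp: E0_def)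
          have pr: "p = x \<and> r = w \<or> p = w \<and> r = x" using p by (auto simp: doubleton_eq_iff)
          show "p \<noteq> v" "v \<noteq> r" "p \<noteq> r" using pr xv vw p(2) by auto
          show "{p, v} \<notin> E0" "{v, r} \<notin> E0" using pr by (auto simp: E0_def insert_commute)
          show "E = insert {v, r} (insert {p, v} E0)"
            using pr vw(1) x(1) by (auto simp: E0_def nbrs_def insert_commute)
          show "degree E v = m" "degree E r = m" using pr dx w(2) by (auto simp: m_def)
          show "4 * m < card K + 5" "3 * m < card K + 2" using w(3,4) cK(3,4) by auto
          have dp: "degree E p = m" using pr dx w(2) by auto
          have "v \<in> nbrs E p" using pr x(1) w(1) nbrs_sym by metis
          then have "card (nbrs E p - {v}) = m - 1" using dp fn by (simp add: degree_def)
          moreover have "card {u \<in> nbrs E p - {v}. degree E u = degree E p} \<le> card (nbrs E p - {v})"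
            by (rule card_mono) (use fn in auto)
          ultimately show "degree E p + m + card {u \<in> nbrs E p - {v}. degree E u = degree E p} < card K + 2"
            using dp w(3,4) cK(3) m1 by auto
        qed (use sub in auto)
        show ?thesis
          using step[of x w] step[of w x] x(2) by (auto simp: insert_commute)
      next
        case False
        \<comment> \<open>\<open>{v, w}\<close> is an isolated edge, hence outside
          \<open>dist_edges E\<close>.\<close>
        then have nv: "nbrs E v = {w}" using w(1) by blast
        then have "m = 1" by (simp add: m_def degree_def)
        have nw: "nbrs E w = {v}"
        proof -
          have "card (nbrs E w) = 1" using w(2) \<open>m = 1\<close> by (simp add: degree_def)
          moreover have "v \<in> nbrs E w" using w(1) nbrs_sym by metis
          ultimately show ?thesis by (metis card_1_singletonE singletonD)
        qed
        define E0 where "E0 = E - {{v, w}}"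
        have "E0 \<subset> E" using vw(1) by (auto simp: E0_def)
        then obtain g where g: "dist_edge_coloring K E0 (dist_edges E0) g" using IH by blast
        show ?thesis
        proof (rule extend_one[where x = v and y = w, OF _ _ _ _ _ g])
          show "\<forall>e\<in>E0. card e = 2" "finite E0" using E by (auto simp: E0_def)
          show "{v, w} \<notin> E0" by (auto simp: E0_def)
          show "E = insert {v, w} E0" using vw(1) by (auto simp: E0_def)
          show "v \<noteq> w" using vw by simp
          show "degree E w \<noteq> degree E v" if "{v, w} \<in> dist_edges E"
            using that w(2) \<open>m = 1\<close> by (auto simp: dist_edges_def m_def)
          show "degree E u \<noteq> degree E w" if "u \<in> nbrs E w" "u \<noteq> v" for u
            using that nw by simp
          have "{u \<in> nbrs E v - {w}. degree E u = degree E v} = {}" using nv by auto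
          then have "card {u \<in> nbrs E v - {w}. degree E u = degree E v} = 0"
            by (simp only: card.empty)
          then show "degree E v + degree E w + card {u \<in> nbrs E v - {w}. degree E u = degree E v} < card K + 2"
            using w(2) \<open>m = 1\<close> cK(1) m_def by linarith
        qed
      qed
    qed
  qed
qed

section \<open>Vertex colorings\<close>

lemma nbrs_outside:
  assumes "simple_graph V E" "x \<notin> V"
  shows "nbrs E x = {}"
  using simple_graph.edges[OF assms(1)] assms(2) by (auto simp: nbrs_def)

text \<open>A vertex of minimum degree in the subgraph induced on \<open>U\<close> serves; if
  \<open>U\<close> leaves \<open>V\<close>, a vertex outside \<open>V\<close> does, having no
  neighbors.\<close>

lemma degenerated_imp_weakly_degenerate:
  assumes G: "simple_graph V E" and k: "degenerated k V E"
  shows "weakly_degenerate k E"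
  unfolding weakly_degenerate_def
proof (intro allI impI)
  fix U :: "'a set" assume U: "finite U" "U \<noteq> {}"
  show "\<exists>x\<in>U. card (nbrs E x \<inter> U) \<le> k"
  proof (cases "U \<subseteq> V")
    case True
    define E' where "E' = {e \<in> E. e \<subseteq> U}"
    have "simple_graph U E'"
      using U simple_graph.edges[OF G] by (auto simp: simple_graph_def E'_def)
    then have "min_degree U E' \<le> k"
      using k True U by (auto simp: degenerated_def subgraph_def E'_def)
    moreover have "min_degree U E' \<in> degree E' ` U"
      unfolding min_degree_def using U by (intro Min_in) auto
    ultimately obtain x where x: "x \<in> U" "degree E' x \<le> k" by auto
    then have "nbrs E' x = nbrs E x \<inter> U" by (auto simp: nbrs_def E'_def)
    then show ?thesis using x by (auto simp: degree_def)
  next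
    case False
    then show ?thesis using nbrs_outside[OF G] by fastforce
  qed
qed

text \<open>A vertex with at most \<open>k\<close> neighbors in \<open>U\<close> is colored last.
  Sparsity is assumed only for subsets of \<open>U\<close>, since the lemma is also applied with
  \<open>k = 1\<close> to part of a graph that may contain cycles.\<close>

lemma greedy_coloring:
  assumes "finite U"
    and "\<And>W. W \<subseteq> U \<Longrightarrow> W \<noteq> {} \<Longrightarrow> \<exists>x\<in>W. card (nbrs E x \<inter> W) \<le> k"
  shows "\<exists>c. c ` U \<subseteq> {1..k + 1} \<and>
    (\<forall>u\<in>U. \<forall>v\<in>U. u \<noteq> v \<longrightarrow> {u, v} \<in> E \<longrightarrow> c u \<noteq> (c v :: nat))"
  using assms
proof (induction "card U" arbitrary: U rule: less_induct)
  case less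
  show ?case
  proof (cases "U = {}")
    case True
    then show ?thesis by simp
  next
    case False
    then obtain x where x: "x \<in> U" "card (nbrs E x \<inter> U) \<le> k" using less.prems(2)[of U] by blast
    have "\<exists>c. c ` (U - {x}) \<subseteq> {1..k + 1} \<and>
      (\<forall>u\<in>U - {x}. \<forall>v\<in>U - {x}. u \<noteq> v \<longrightarrow> {u, v} \<in> E \<longrightarrow> c u \<noteq> (c v :: nat))"
    proof (rule less.hyps)
      show "card (U - {x}) < card U" using x(1) less.prems(1) by (meson card_Diff1_less)
      show "finite (U - {x})" using less.prems(1) by simp
      show "\<exists>x\<in>W. card (nbrs E x \<inter> W) \<le> k" if "W \<subseteq> U - {x}" "W \<noteq> {}" for W
        using less.prems(2)[of W] that by blast
    qed
    then obtain c where c: "c ` (U - {x}) \<subseteq> {1..k + 1}"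
      "\<forall>u\<in>U - {x}. \<forall>v\<in>U - {x}. u \<noteq> v \<longrightarrow> {u, v} \<in> E \<longrightarrow> c u \<noteq> (c v :: nat)"
      by (elim exE conjE)
    have f: "finite (nbrs E x \<inter> U)" using less.prems(1) by simp
    have "card (c ` (nbrs E x \<inter> U)) < card {1..k + 1}"
      using card_image_le[OF f, of c] x(2) by simp
    then have "\<not> {1..k + 1} \<subseteq> c ` (nbrs E x \<inter> U)"
      using f by (meson card_mono finite_imageI not_le)
    then obtain a where a: "a \<in> {1..k + 1}" "a \<notin> c ` (nbrs E x \<inter> U)" by blast
    have "(c(x := a)) u \<noteq> (c(x := a)) v" if "u \<in> U" "v \<in> U" "u \<noteq> v" "{u, v} \<in> E" for u v
    proof -
      have "{v, u} \<in> E" using that(4) by (simp add: insert_commute)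
      then show ?thesis using that a(2) c(2) by (auto simp: nbrs_def)
    qed
    moreover have "(c(x := a)) ` U \<subseteq> {1..k + 1}" using a(1) c(1) by auto
    ultimately show ?thesis by blast
  qed
qed

section \<open>Combining vertex and edge colorings\<close>

lemma color_set_case_sum:
  assumes "\<forall>e\<in>E. card e = 2"
  shows "color_set E (case_sum h g) u = h ` closed_nbrs E u \<union> edge_colors E g u"
proof -
  have "{{u, v} |v. v \<in> nbrs E u} = {e \<in> E. u \<in> e}"
    using inc_eq_image[OF assms, of u] by auto
  then show ?thesis
    unfolding color_set_def total_nbhd_def edge_colors_def
    by (simp add: Plus_def image_Un image_image)
qed

text \<open>The palettes of vertices and edges may overlap, so \<open>hg\<close> and
  \<open>ne\<close> are stated for the actual colors and the full color sets.\<close>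

lemma D1_VSDTC_case_sum:
  assumes G: "simple_graph V E"
    and h: "h ` V \<subseteq> {1..\<kappa>}" "\<And>u v. {u, v} \<in> E \<Longrightarrow> h u \<noteq> h v"
    and g: "dist_edge_coloring K E T g" "K \<subseteq> {1..\<kappa>}"
    and hg: "\<And>v. v \<in> V \<Longrightarrow> h v \<notin> edge_colors E g v"
    and ne: "\<And>u v. {u, v} \<in> E \<Longrightarrow> h ` closed_nbrs E u \<union> edge_colors E g u
        \<noteq> h ` closed_nbrs E v \<union> edge_colors E g v"
  shows "D1_VSDTC V E \<kappa> (case_sum h g)"
proof -
  have E: "\<forall>e\<in>E. card e = 2" and EV: "\<forall>e\<in>E. e \<subseteq> V" using simple_graph.edges[OF G] by auto
  have "g ` E \<subseteq> {1..\<kappa>}" using g by (auto simp: dist_edge_coloring_def)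
  then have "case_sum h g ` (V <+> E) \<subseteq> {1..\<kappa>}" using h(1) by auto
  moreover have "\<forall>e\<in>E. \<forall>v\<in>e. h v \<noteq> g e"
    using hg EV by (force simp: edge_colors_def)
  moreover have "\<forall>e\<in>E. \<forall>e'\<in>E. e \<noteq> e' \<and> e \<inter> e' \<noteq> {} \<longrightarrow> g e \<noteq> g e'"
    using g(1) by (simp add: dist_edge_coloring_def)
  ultimately show ?thesis
    unfolding D1_VSDTC_def proper_total_coloring_def color_set_case_sum[OF E]
    using h(2) ne by simp
qed

text \<open>If both ends had degree 1, only \<open>{u, v}\<close> would be reachable from
  \<open>u\<close>, forming a component. This puts every edge into
  \<open>dist_edges E\<close>.\<close>

lemma degree_ge_2:
  assumes G: "simple_graph V E" and iso: "no_isolated_edges V E" and uv: "{u, v} \<in> E"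
  shows "2 \<le> degree E u \<or> 2 \<le> degree E v"
proof (rule ccontr)
  have E: "\<forall>e\<in>E. card e = 2" and EV: "{u, v} \<subseteq> V" using simple_graph.edges[OF G] uv by auto
  have "E \<subseteq> Pow V" using simple_graph.edges[OF G] by blast
  then have fE: "finite E" using simple_graph.finite_V[OF G] by (meson finite_Pow_iff finite_subset)
  have ne: "u \<noteq> v" using E uv by auto
  assume "\<not> ?thesis"
  then have c: "card (nbrs E u) \<le> 1" "card (nbrs E v) \<le> 1" by (auto simp: degree_def)
  have n: "v \<in> nbrs E u" "u \<in> nbrs E v" using uv by (auto simp: nbrs_def insert_commute)
  have "nbrs E u = {v}" "nbrs E v = {u}"
    using c n finite_nbrs[OF E fE] by (auto simp: card_le_Suc0_iff_eq)
  then have only: "{u, w} \<in> E \<longleftrightarrow> w = v" "{v, w} \<in> E \<longleftrightarrow> w = u" for w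
    by (auto simp: nbrs_def)
  let ?R = "{(x, y). {x, y} \<in> E}"
  have "w \<in> {u, v}" if "(u, w) \<in> ?R\<^sup>*" for w
    using that by induction (use only in auto)
  then have "{(x, y). x \<in> V \<and> y \<in> V \<and> (x, y) \<in> ?R\<^sup>*} `` {u} = {u, v}"
    using EV uv by auto
  moreover have "{(x, y). x \<in> V \<and> y \<in> V \<and> (x, y) \<in> ?R\<^sup>*} `` {u} \<in> components V E"
    unfolding components_def by (rule quotientI) (use EV in simp)
  ultimately show False using iso uv ne unfolding no_isolated_edges_def by metis
qed

text \<open>Vertices use \<open>{1..k + 1}\<close>, so intersecting a total color set with the edge
  palette returns the edge colors, which already differ at adjacent vertices.\<close>

lemma D1_VSDTC_disjoint_palettes:
  assumes G: "simple_graph V E" and iso: "no_isolated_edges V E"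
    and k: "weakly_degenerate k E"
    and g: "dist_edge_coloring {k + 2..\<kappa>} E (dist_edges E) g" and \<kappa>: "k < \<kappa>"
  shows "\<exists>f. D1_VSDTC V E \<kappa> f"
proof -
  have E: "\<forall>e\<in>E. card e = 2" and EV: "\<And>e. e \<in> E \<Longrightarrow> e \<subseteq> V" using simple_graph.edges[OF G] by auto
  have fV: "finite V" using simple_graph.finite_V[OF G] .
  have "\<exists>h. h ` V \<subseteq> {1..k + 1} \<and>
    (\<forall>u\<in>V. \<forall>v\<in>V. u \<noteq> v \<longrightarrow> {u, v} \<in> E \<longrightarrow> h u \<noteq> (h v :: nat))"
  proof (rule greedy_coloring[OF fV])
    fix W assume W: "W \<subseteq> V" "W \<noteq> {}"
    then show "\<exists>x\<in>W. card (nbrs E x \<inter> W) \<le> k"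
      using k finite_subset[OF W(1) fV] by (simp add: weakly_degenerate_def)
  qed
  then obtain h where h: "h ` V \<subseteq> {1..k + 1}"
    "\<forall>u\<in>V. \<forall>v\<in>V. u \<noteq> v \<longrightarrow> {u, v} \<in> E \<longrightarrow> h u \<noteq> (h v :: nat)"
    by (elim exE conjE)
  have gK: "edge_colors E g u \<subseteq> {k + 2..\<kappa>}" for u
    using g by (auto simp: dist_edge_coloring_def edge_colors_def)
  have nV: "closed_nbrs E u \<subseteq> V" if "u \<in> V" for u
    using that EV by (auto simp: closed_nbrs_def nbrs_def)
  have rest: "(h ` closed_nbrs E u \<union> edge_colors E g u) \<inter> {k + 2..\<kappa>} = edge_colors E g u"
    if "u \<in> V" for u
  proof -
    have "h ` closed_nbrs E u \<subseteq> {1..k + 1}" using nV[OF that] h(1) by blast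
    then have "h ` closed_nbrs E u \<inter> {k + 2..\<kappa>} = {}" by fastforce
    then show ?thesis using gK[of u] by blast
  qed
  have "D1_VSDTC V E \<kappa> (case_sum h g)"
  proof (rule D1_VSDTC_case_sum[OF G _ _ g])
    show "h ` V \<subseteq> {1..\<kappa>}" using h(1) \<kappa> by fastforce
    show "{k + 2..\<kappa>} \<subseteq> {1..\<kappa>}" by auto
    fix u v
    assume uv: "{u, v} \<in> E"
    then have ne: "u \<noteq> v" using E by auto
    have V: "u \<in> V" "v \<in> V" using EV[OF uv] by auto
    show "h u \<noteq> h v" using h(2) ne V uv by blast
    have "{u, v} \<in> dist_edges E" using degree_ge_2[OF G iso uv] uv by (auto simp: dist_edges_def)
    then have "edge_colors E g u \<noteq> edge_colors E g v"
      using g ne by (simp add: dist_edge_coloring_def)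
    then show "h ` closed_nbrs E u \<union> edge_colors E g u \<noteq> h ` closed_nbrs E v \<union> edge_colors E g v"
      using rest V by metis
  next
    fix v assume "v \<in> V"
    then show "h v \<notin> edge_colors E g v" using h(1) gK[of v] by fastforce
  qed
  then show ?thesis by blast
qed

text \<open>A graph of maximum degree 2 becomes a forest, hence 2-colorable, after removing one
  vertex \<open>w\<close> from every component. Coloring each such \<open>w\<close> with an edge color that does not
  occur at \<open>w\<close> or its neighbors leaves five colors for the edges.\<close>

lemma D1_VSDTC_degree_2:
  assumes G: "simple_graph V E" and iso: "no_isolated_edges V E"
    and deg: "\<And>u. degree E u \<le> 2"
    and g: "dist_edge_coloring {3..7} E (dist_edges E) g"
  shows "\<exists>f. D1_VSDTC V E 7 f"
proof -
  have E: "\<forall>e\<in>E. card e = 2" and EV: "\<And>e. e \<in> E \<Longrightarrow> e \<subseteq> V" using simple_graph.edges[OF G] by auto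
  have fV: "finite V" using simple_graph.finite_V[OF G] .
  have "E \<subseteq> Pow V" using EV by blast
  then have fE: "finite E" using fV by (meson finite_Pow_iff finite_subset)
  note fn = finite_nbrs[OF E fE] and ce = card_edge_colors[OF E g] and fe = finite_edge_colors[OF fE]
  let ?R = "{(x, y). {x, y} \<in> E}\<^sup>*"
  have "sym {(x, y). {x, y} \<in> E}" by (auto simp: sym_def insert_commute)
  then have symR: "sym ?R" by (rule sym_rtrancl)
  \<comment> \<open>The predicate is the same for all vertices of a component, so the choice is
    too.\<close>
  define rep where "rep u = (SOME x. (u, x) \<in> ?R)" for u
  have rep: "(u, rep u) \<in> ?R" for u unfolding rep_def by (rule someI[of _ u]) simp
  have rep_eq: "rep u = rep v" if "(u, v) \<in> ?R" for u v
  proof -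
    have "(u, x) \<in> ?R \<longleftrightarrow> (v, x) \<in> ?R" for x
      using that symR by (meson rtrancl_trans symD)
    then show ?thesis by (simp add: rep_def)
  qed
  have rep_adj: "rep u = rep v" if "{u, v} \<in> E" for u v
    using that by (intro rep_eq) auto
  define W where "W = {u \<in> V. rep u = u}"
  have "\<exists>h. h ` (V - W) \<subseteq> {1..1 + 1} \<and>
    (\<forall>u\<in>V - W. \<forall>v\<in>V - W. u \<noteq> v \<longrightarrow> {u, v} \<in> E \<longrightarrow> h u \<noteq> (h v :: nat))"
  proof (rule greedy_coloring)
    show "finite (V - W)" using fV by simp
    fix U assume U: "U \<subseteq> V - W" "U \<noteq> {}"
    show "\<exists>x\<in>U. card (nbrs E x \<inter> U) \<le> 1"
    proof (rule ccontr)
      assume "\<not> ?thesis"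
      then have c: "2 \<le> card (nbrs E x \<inter> U)" if "x \<in> U" for x using that by force
      \<comment> \<open>With two neighbors inside \<open>U\<close>, a vertex has none outside. Then
        \<open>U\<close> contains a whole component, and with it the chosen vertex in
        \<open>W\<close>.\<close>
      have closed: "nbrs E x \<subseteq> U" if "x \<in> U" for x
      proof -
        have "nbrs E x \<inter> U = nbrs E x"
          using c[OF that] deg[of x] fn[of x] by (intro card_seteq) (auto simp: degree_def)
        then show ?thesis by blast
      qed
      obtain x where x: "x \<in> U" using U by blast
      have "y \<in> U" if "(x, y) \<in> ?R" for y
        using that by induction (use x closed in \<open>auto simp: nbrs_def\<close>)
      then have "rep x \<in> U" using rep by blast
      moreover have "rep (rep x) = rep x" using rep_eq[OF rep[of x]] by simp
      ultimately show False using U by (auto simp: W_def)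
    qed
  qed
  then obtain h0 where h0: "h0 ` (V - W) \<subseteq> {1..1 + 1}"
    "\<forall>u\<in>V - W. \<forall>v\<in>V - W. u \<noteq> v \<longrightarrow> {u, v} \<in> E \<longrightarrow> h0 u \<noteq> (h0 v :: nat)"
    by (elim exE conjE)
  \<comment> \<open>Each edge at \<open>w\<close> is also an edge at a neighbor of \<open>w\<close>.
    At most two neighbors with at most two colors each leave one of the five colors free.\<close>
  have "\<exists>c\<in>{3..7}. \<forall>u\<in>closed_nbrs E w. c \<notin> edge_colors E g u" for w
  proof -
    let ?F = "\<Union>u\<in>nbrs E w. edge_colors E g u"
    have F: "edge_colors E g u \<subseteq> ?F" if "u \<in> closed_nbrs E w" for u
    proof (cases "u \<in> nbrs E w")
      case False
      then have "u = w" using that by (simp add: closed_nbrs_def)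
      show ?thesis
      proof
        fix a assume "a \<in> edge_colors E g u"
        then obtain e where e: "e \<in> {e \<in> E. w \<in> e}" "a = g e"
          unfolding \<open>u = w\<close> edge_colors_def by blast
        then obtain x where "x \<in> nbrs E w" "e = {w, x}" unfolding inc_eq_image[OF E] by blast
        then show "a \<in> ?F" using e unfolding edge_colors_def by blast
      qed
    qed auto
    have "card ?F \<le> (\<Sum>u\<in>nbrs E w. card (edge_colors E g u))" by (rule card_UN_le[OF fn])
    also have "\<dots> \<le> (\<Sum>u\<in>nbrs E w. 2)" using deg by (intro sum_mono) (simp add: ce)
    also have "\<dots> \<le> 4" using deg[of w] by (simp add: degree_def)
    finally have "card ?F < card {3..7::nat}" by simp
    moreover have "finite ?F" using fn fe by simp
    ultimately have "\<not> {3..7} \<subseteq> ?F" using card_mono[of ?F "{3..7}"] by linarith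
    then show ?thesis using F by blast
  qed
  then obtain c where c: "c w \<in> {3..7}" "\<And>u. u \<in> closed_nbrs E w \<Longrightarrow> c w \<notin> edge_colors E g u" for w
    by metis
  define h where "h u = (if u \<in> W then c u else h0 u)" for u
  have hW: "h u \<in> {3..7}" if "u \<in> W" for u using c that by (simp add: h_def)
  have hV: "h u \<in> {1..2}" if "u \<in> V - W" for u using h0(1) that by (auto simp: h_def)
  have gK: "edge_colors E g u \<subseteq> {3..7}" for u
    using g by (auto simp: dist_edge_coloring_def edge_colors_def)
  \<comment> \<open>In the component of \<open>u\<close> only \<open>rep u\<close> has a vertex
    color in \<open>{3..7}\<close>, so at most one color is added to the edge colors.\<close>
  have rest: "(h ` closed_nbrs E u \<union> edge_colors E g u) \<inter> {3..7} =
      (if rep u \<in> closed_nbrs E u then insert (c (rep u)) (edge_colors E g u) else edge_colors E g u)"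
    if u: "u \<in> V" for u
  proof -
    have nV: "closed_nbrs E u \<subseteq> V"
      using u EV by (auto simp: closed_nbrs_def nbrs_def)
    have repW: "x \<in> W \<longleftrightarrow> x = rep u" if "x \<in> closed_nbrs E u" for x
    proof -
      have "rep x = rep u" using that rep_adj by (auto simp: closed_nbrs_def nbrs_def)
      then show ?thesis using that nV rep_eq[OF rep[of u]] by (auto simp: W_def)
    qed
    have "h ` closed_nbrs E u \<inter> {3..7} = h ` (closed_nbrs E u \<inter> W)"
    proof
      show "h ` closed_nbrs E u \<inter> {3..7} \<subseteq> h ` (closed_nbrs E u \<inter> W)"
      proof
        fix y assume "y \<in> h ` closed_nbrs E u \<inter> {3..7}"
        then obtain x where x: "x \<in> closed_nbrs E u" "y = h x" "3 \<le> h x" by auto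
        then have "x \<in> W" using nV hV[of x] by fastforce
        then show "y \<in> h ` (closed_nbrs E u \<inter> W)" using x by blast
      qed
    qed (use hW in auto)
    also have "\<dots> = (if rep u \<in> closed_nbrs E u then {c (rep u)} else {})"
    proof -
      have "closed_nbrs E u \<inter> W = (if rep u \<in> closed_nbrs E u then {rep u} else {})"
        using repW by auto
      then show ?thesis using repW by (auto simp: h_def)
    qed
    finally show ?thesis using gK[of u] by (auto simp: Int_Un_distrib2)
  qed
  have cl_sym: "u \<in> closed_nbrs E v \<longleftrightarrow> v \<in> closed_nbrs E u" for u v
    using nbrs_sym[of u E v] by (auto simp: closed_nbrs_def)
  \<comment> \<open>Equality would give \<open>degree E u + 1 = degree E v \<le> 2\<close>, yet
    \<open>u\<close> has the two distinct neighbors \<open>v\<close> and \<open>w\<close>.\<close>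
  have half: "insert (c w) (edge_colors E g u) \<noteq> edge_colors E g v"
    if "{u, v} \<in> E" "w \<in> closed_nbrs E u" "w \<notin> closed_nbrs E v" for u v w
  proof
    assume "insert (c w) (edge_colors E g u) = edge_colors E g v"
    moreover have "c w \<notin> edge_colors E g u" using c that cl_sym by blast
    ultimately have "degree E u + 1 = degree E v"
      using ce[of u] ce[of v] fe[of g u] by (metis Suc_eq_plus1 card_insert_disjoint)
    then have "degree E u \<le> 1" using deg[of v] by linarith
    moreover have "w \<noteq> v" "w \<noteq> u" "v \<in> nbrs E u"
      using that by (auto simp: closed_nbrs_def nbrs_def insert_commute)
    moreover have "w \<in> nbrs E u" using that \<open>w \<noteq> u\<close> by (simp add: closed_nbrs_def)
    ultimately show False
      using fn[of u] by (auto simp: degree_def card_le_Suc0_iff_eq)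
  qed
  have "D1_VSDTC V E 7 (case_sum h g)"
  proof (rule D1_VSDTC_case_sum[OF G _ _ g])
    show "h ` V \<subseteq> {1..7}" using hW hV by fastforce
    show "{3..7} \<subseteq> {1..7::nat}" by auto
    fix u v
    assume uv: "{u, v} \<in> E"
    then have ne: "u \<noteq> v" using E by auto
    have vu: "{v, u} \<in> E" using uv by (simp add: insert_commute)
    have V: "u \<in> V" "v \<in> V" using EV[OF uv] by auto
    have r: "rep v = rep u" using rep_adj[OF uv] by simp
    then have "\<not> (u \<in> W \<and> v \<in> W)" using ne by (auto simp: W_def)
    then consider "u \<in> V - W" "v \<in> V - W" | "u \<in> W" "v \<in> V - W" | "u \<in> V - W" "v \<in> W"
      using V by blast
    then show "h u \<noteq> h v"
    proof cases
      case 1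
      then show ?thesis using h0(2) ne uv by (simp add: h_def)
    next
      case 2
      then show ?thesis using hW[of u] hV[of v] by auto
    next
      case 3
      then show ?thesis using hW[of v] hV[of u] by auto
    qed
    have "{u, v} \<in> dist_edges E" using degree_ge_2[OF G iso uv] uv by (auto simp: dist_edges_def)
    then have ne_uv: "edge_colors E g u \<noteq> edge_colors E g v"
      using g ne by (simp add: dist_edge_coloring_def)
    \<comment> \<open>If both vertices see the color of \<open>rep u\<close>, it is new to both sets
      of edge colors and can be cancelled; if just one does, \<open>half\<close> applies.\<close>
    have "(if rep u \<in> closed_nbrs E u then insert (c (rep u)) (edge_colors E g u) else edge_colors E g u)
      \<noteq> (if rep u \<in> closed_nbrs E v then insert (c (rep u)) (edge_colors E g v) else edge_colors E g v)"
    proof (cases "rep u \<in> closed_nbrs E u"; cases "rep u \<in> closed_nbrs E v")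
      assume "rep u \<in> closed_nbrs E u" "rep u \<in> closed_nbrs E v"
      then show ?thesis
        using ne_uv c(2)[of u "rep u"] c(2)[of v "rep u"] cl_sym by (metis Diff_insert_absorb)
    qed (use half[OF uv] half[OF vu] ne_uv in \<open>auto dest: sym\<close>)
    then show "h ` closed_nbrs E u \<union> edge_colors E g u \<noteq> h ` closed_nbrs E v \<union> edge_colors E g v"
      using rest[OF V(1)] rest[OF V(2)] r by metis
  next
    fix v assume v: "v \<in> V"
    show "h v \<notin> edge_colors E g v"
    proof (cases "v \<in> W")
      case True
      then show ?thesis using c(2)[of v v] by (simp add: h_def closed_nbrs_def)
    next
      case False
      then show ?thesis using hV[of v] v gK[of v] by fastforce
    qed
  qed
  then show ?thesis by blast
qed

section \<open>Counting colors and the final bound\<close>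

lemma ex_D1_VSDTC_bound:
  assumes G: "simple_graph V E" and iso: "no_isolated_edges V E"
    and wd: "weakly_degenerate k E" and deg: "\<And>u. degree E u \<le> D"
    and k: "2 \<le> k" "k \<le> D"
  shows "\<exists>f. D1_VSDTC V E (k * D + 3) f"
proof -
  have E: "\<forall>e\<in>E. card e = 2" and "E \<subseteq> Pow V" using simple_graph.edges[OF G] by auto
  then have fE: "finite E" using simple_graph.finite_V[OF G] by (meson finite_Pow_iff finite_subset)
  show ?thesis
  proof (cases "D = 2")
    case True
    then have "k = 2" using k by simp
    \<comment> \<open>The total is 7, and \<open>3 * min k D < card K + 2\<close> asks for five edge
      colors.\<close>
    have "\<exists>g. dist_edge_coloring {3..7} E (dist_edges E) g"
      by (rule ex_dist_edge_coloring[OF E fE wd deg]) (use True k in auto)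
    then show ?thesis using D1_VSDTC_degree_2[OF G iso] deg True \<open>k = 2\<close> by auto
  next
    case False
    \<comment> \<open>The shift to \<open>d\<close> and \<open>j\<close> removes truncated
      subtraction from the palette size \<open>k * (D - 1) + 2\<close>. For \<open>k = D = 3\<close>
      nothing is to spare: eight colors against \<open>4 * 3 - 5 = 7\<close> barred ones.\<close>
    then obtain d where d: "D = d + 3" using k by (metis add.commute le_Suc_ex eval_nat_numeral(3) le_antisym le_trans not_less_eq_eq)
    obtain j where j: "k = j + 2" using k by (metis add.commute le_Suc_ex)
    have "card {k + 2..k * D + 3} = j * d + 2 * j + 2 * d + 6"
      by (simp add: d j algebra_simps)
    moreover have "j \<le> d + 1" using k d j by simp
    moreover have "j \<le> j * d + 1" by (cases d) (use k d j in auto)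
    moreover have "2 * j \<le> j * d + d + 2"
    proof (cases "d \<le> 1")
      case True
      then have "d = 0 \<or> d = 1" by auto
      then show ?thesis using \<open>j \<le> d + 1\<close> by auto
    next
      case False
      then have "j * 2 \<le> j * d" by (intro mult_le_mono2) simp
      then show ?thesis by linarith
    qed
    ultimately have "\<exists>g. dist_edge_coloring {k + 2..k * D + 3} E (dist_edges E) g"
      by (intro ex_dist_edge_coloring[OF E fE wd deg]) (use k d j in auto)
    moreover have "k < k * D + 3" using k by (cases D) auto
    ultimately show ?thesis using D1_VSDTC_disjoint_palettes[OF G iso wd] by blast
  qed
qed

theorem theorem1p9:
  fixes V :: "'a set" and E :: "'a set set" and k :: nat
  assumes "simple_graph V E"
    and "k \<ge> 2"
    and "degenerated k V E"
    and "no_isolated_edges V E"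
  shows "chi_1vsdt V E \<le> k * max_degree V E + 3"
proof -
  note G = assms(1)
  let ?D = "max_degree V E"
  have deg: "degree E u \<le> ?D" for u
  proof (cases "u \<in> V")
    case True
    then show ?thesis
      unfolding max_degree_def using simple_graph.finite_V[OF G] by (intro cSUP_upper) auto
  next
    case False
    then show ?thesis using nbrs_outside[OF G] by (simp add: degree_def)
  qed
  have chi: "chi_1vsdt V E \<le> \<kappa>" if "D1_VSDTC V E \<kappa> f" for \<kappa> f
    unfolding chi_1vsdt_def using that by (intro Least_le) blast
  have E: "\<forall>e\<in>E. card e = 2" and "E \<subseteq> Pow V" using simple_graph.edges[OF G] by auto
  then have fE: "finite E" using simple_graph.finite_V[OF G] by (meson finite_Pow_iff finite_subset)
  show ?thesis
  proof (cases "2 \<le> ?D")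
    case True
    \<comment> \<open>No vertex has more than \<open>?D\<close> neighbors, so \<open>k\<close> can
      be lowered to \<open>min k ?D\<close>, as the bound requires \<open>k \<le> D\<close>.\<close>
    have "card (nbrs E x \<inter> U) \<le> ?D" for x U
      using card_mono[OF finite_nbrs[OF E fE], of "nbrs E x \<inter> U" x] deg[of x]
      by (simp add: degree_def)
    then have "weakly_degenerate (min k ?D) E"
      using degenerated_imp_weakly_degenerate[OF G assms(3)]
      by (auto simp: weakly_degenerate_def)
    then obtain f where "D1_VSDTC V E (min k ?D * ?D + 3) f"
      using ex_D1_VSDTC_bound[OF G assms(4) _ deg] True assms(2) by fastforce
    then have "chi_1vsdt V E \<le> min k ?D * ?D + 3" by (rule chi)
    also have "\<dots> \<le> k * ?D + 3" by (intro add_right_mono mult_le_mono1) simp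
    finally show ?thesis .
  next
    case False
    \<comment> \<open>With maximum degree at most 1 every edge would be isolated.\<close>
    have "E = {}"
    proof (rule ccontr)
      assume "E \<noteq> {}"
      then obtain u v where "{u, v} \<in> E" using E by (metis all_not_in_conv card_2_iff)
      then show False using degree_ge_2[OF G assms(4)] deg False by (meson le_trans)
    qed
    then have "D1_VSDTC V E 1 (\<lambda>_. 1)" by (auto simp: D1_VSDTC_def proper_total_coloring_def)
    then show ?thesis using chi by fastforce
  qed
qed

end
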